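(* For every hypersequent $G$: if $G$ is derivable in the hypersequent calculus $\mathbf{HR}$, then $[\![G]\!]\geq 0$ is derivable in equational logic from the axioms of Riesz spaces, i.e. the inequality $[\![G]\!]\geq 0$ holds in every Riesz space under every assignment of the variables.
   Context: Terms. Fix a countable set of variables $x,y,z,\dots$. Terms (in negation normal form) are generated by $A ::= x \mid \overline{x} \mid 0 \mid A+A \mid rA \mid A\sqcup A \mid A\sqcap A$, where $x$ is a variable, $\overline{x}$ is the corresponding negated variable, and $r\in\mathbb{R}_{>0}$. The negation $\overline{A}$ of a term is defined by $\overline{x}$ (for $x$), $\overline{\overline{x}}=x$, $\overline{0}=0$, $\overline{A+B}=\overline{A}+\overline{B}$, $\overline{rA}=r\overline{A}$, $\overline{A\sqcup B}=\overline{A}\sqcap\overline{B}$, $\overline{A\sqcap B}=\overline{A}\sqcup\overline{B}$. Terms are interpreted in Riesz spaces (vector lattices) reading $\overline{x}$ as $-x$, $rA$ as scalar multiplication, and $\sqcup,\sqcap$ as join and meet. A weighted term is $r.A$ with $r\in\mathbb{R}_{>0}$; a sequent $\vdash\Gamma$ has $\Gamma$ a finite (possibly empty) multiset of weighted terms; a hypersequent is a nonempty finite multiset of sequents, written $\vdash\Gamma_1\mid\cdots\mid\vdash\Gamma_n$, and $G\mid\vdash\Gamma$ denotes the hypersequent $G$ with the sequent $\vdash\Gamma$ added. For a finite (possibly empty) sequence $\vec r=(r_1,\dots,r_n)$ of strictly positive reals, $\vec r.A$ is the multiset $r_1.A,\dots,r_n.A$, $\sum\vec r=r_1+\dots+r_n$,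 and $s\vec r=(sr_1,\dots,sr_n)$; for $s>0$, $s.\Gamma$ multiplies every weight in $\Gamma$ by $s$. Interpretation: $[\![r.A]\!]=rA$; $[\![\vdash r_1.A_1,\dots,r_n.A_n]\!]=r_1A_1+\dots+r_nA_n$ (empty sum $=0$); $[\![\vdash\Gamma_1\mid\dots\mid\vdash\Gamma_n]\!]=[\![\vdash\Gamma_1]\!]\sqcup\dots\sqcup[\![\vdash\Gamma_n]\!]$. The calculus $\mathbf{HR}$ has the rules (vectors are finite sequences of strictly positive reals): INIT: the hypersequent $\vdash$ (one empty sequent) with no premises. W: from $G$ infer $G\mid\vdash\Gamma$. C: from $G\mid\vdash\Gamma\mid\vdash\Gamma$ infer $G\mid\vdash\Gamma$. S: from $G\mid\vdash\Gamma_1,\Gamma_2$ infer $G\mid\vdash\Gamma_1\mid\vdash\Gamma_2$. M: from $G\mid\vdash\Gamma_1$ and $G\mid\vdash\Gamma_2$ infer $G\mid\vdash\Gamma_1,\Gamma_2$. T: for $r>0$, from $G\mid\vdash r.\Gamma$ infer $G\mid\vdash\Gamma$. ID: if $\sum\vec r=\sum\vec s$, from $G\mid\vdash\Gamma$ infer $G\mid\vdash\Gamma,\vec r.x,\vec s.\overline{x}$ ($x$ a variable). 0: from $G\mid\vdash\Gamma$ infer $G\mid\vdash\Gamma,\vec r.0$. $+$: from $G\mid\vdash\Gamma,\vec r.A,\vec r.B$ infer $G\mid\vdash\Gamma,\vec r.(A+B)$. $\times$: from $G\mid\vdash\Gamma,(s\vec r).A$ infer $G\mid\vdash\Gamma,\vec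 r.(sA)$. $\sqcup$: from $G\mid\vdash\Gamma,\vec r.A\mid\vdash\Gamma,\vec r.B$ infer $G\mid\vdash\Gamma,\vec r.(A\sqcup B)$. $\sqcap$: from $G\mid\vdash\Gamma,\vec r.A$ and $G\mid\vdash\Gamma,\vec r.B$ infer $G\mid\vdash\Gamma,\vec r.(A\sqcap B)$. CAN: if $\sum\vec r=\sum\vec s$, from $G\mid\vdash\Gamma,\vec s.A,\vec r.\overline{A}$ infer $G\mid\vdash\Gamma$. A derivation is a finite tree of rule instances whose leaves are INIT. *)

theory Defs
  imports Complex_Main "HOL-Library.Multiset"
begin

class riesz_space = ordered_real_vector + lattice

typedef preal = "{r::real. 0 < r}"
  morphisms real_of_preal Abs_preal
  by (rule exI[of _ 1]) simp

setup_lifting type_definition_preal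

instantiation preal :: times
begin

lift_definition times_preal :: "preal \<Rightarrow> preal \<Rightarrow> preal" is "\<lambda>r s. r * s"
  by simp

instance ..

end

definition weight :: "preal list \<Rightarrow> real" where
  "weight rs = sum_list (map real_of_preal rs)"


datatype nnf =
    PVar nat
  | NVar nat
  | Zero
  | Plus nnf nnf
  | Scale preal nnf
  | Join nnf nnf
  | Meet nnf nnf

fun neg :: "nnf \<Rightarrow> nnf" where
  "neg (PVar x) = NVar x"
| "neg (NVar x) = PVar x"
| "neg Zero = Zero"
| "neg (Plus A B) = Plus (neg A) (neg B)"
| "neg (Scale r A) = Scale r (neg A)"
| "neg (Join A B) = Meet (neg A) (neg B)"
| "neg (Meet A B) = Join (neg A) (neg B)"

type_synonym weighted = "preal \<times> nnf"
type_synonym sequent = "weighted multiset"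

(* Hypersequents are the nonempty elements of this type. The empty multiset is kept as a
   value so that the side hypersequent G of a rule may be absent; by HR_nonempty below it
   is never derivable. *)
type_synonym hypersequent = "sequent multiset"

definition weigh :: "preal list \<Rightarrow> nnf \<Rightarrow> sequent" where
  "weigh rs A = mset (map (\<lambda>r. (r, A)) rs)"

definition rescale :: "preal \<Rightarrow> sequent \<Rightarrow> sequent" where
  "rescale s \<Gamma> = image_mset (\<lambda>(r, A). (s * r, A)) \<Gamma>"


inductive HR :: "hypersequent \<Rightarrow> bool" where
  INIT: "HR {#{#}#}"
| W: "HR G \<Longrightarrow> HR (add_mset \<Gamma> G)"
| C: "HR (add_mset \<Gamma> (add_mset \<Gamma> G)) \<Longrightarrow> HR (add_mset \<Gamma> G)"
| S: "HR (add_mset (\<Gamma>1 + \<Gamma>2) G) \<Longrightarrow> HR (add_mset \<Gamma>1 (add_mset \<Gamma>2 G))"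
| M: "HR (add_mset \<Gamma>1 G) \<Longrightarrow> HR (add_mset \<Gamma>2 G) \<Longrightarrow> HR (add_mset (\<Gamma>1 + \<Gamma>2) G)"
| T: "HR (add_mset (rescale r \<Gamma>) G) \<Longrightarrow> HR (add_mset \<Gamma> G)"
| ID: "weight rs = weight ss \<Longrightarrow> HR (add_mset \<Gamma> G) \<Longrightarrow>
    HR (add_mset (\<Gamma> + weigh rs (PVar x) + weigh ss (NVar x)) G)"
| zero: "HR (add_mset \<Gamma> G) \<Longrightarrow> HR (add_mset (\<Gamma> + weigh rs Zero) G)"
| plus: "HR (add_mset (\<Gamma> + weigh rs A + weigh rs B) G) \<Longrightarrow>
    HR (add_mset (\<Gamma> + weigh rs (Plus A B)) G)"
| times: "HR (add_mset (\<Gamma> + weigh (map (\<lambda>r. s * r) rs) A) G) \<Longrightarrow>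
    HR (add_mset (\<Gamma> + weigh rs (Scale s A)) G)"
| join: "HR (add_mset (\<Gamma> + weigh rs A) (add_mset (\<Gamma> + weigh rs B) G)) \<Longrightarrow>
    HR (add_mset (\<Gamma> + weigh rs (Join A B)) G)"
| meet: "HR (add_mset (\<Gamma> + weigh rs A) G) \<Longrightarrow> HR (add_mset (\<Gamma> + weigh rs B) G) \<Longrightarrow>
    HR (add_mset (\<Gamma> + weigh rs (Meet A B)) G)"
| CAN: "weight rs = weight ss \<Longrightarrow>
    HR (add_mset (\<Gamma> + weigh ss A + weigh rs (neg A)) G) \<Longrightarrow> HR (add_mset \<Gamma> G)"

lemma HR_nonempty: "HR G \<Longrightarrow> G \<noteq> {#}"
  by (induction rule: HR.induct) simp_all


datatype rterm =
    RVar nat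
  | RZero
  | RPlus rterm rterm
  | RScale real rterm
  | RJoin rterm rterm
  | RMeet rterm rterm

(* The axioms are stated for arbitrary terms, so derivability is closed under substitution.
   An inequality s \<le> t stands for the equation s \<sqinter> t = s; the last two axioms are
   (s \<sqinter> t) + u \<le> t + u and r (s \<sqinter> t) \<le> r t for r \<ge> 0. *)
inductive riesz_eq :: "rterm \<Rightarrow> rterm \<Rightarrow> bool" where
  refl: "riesz_eq t t"
| sym: "riesz_eq s t \<Longrightarrow> riesz_eq t s"
| trans: "riesz_eq s t \<Longrightarrow> riesz_eq t u \<Longrightarrow> riesz_eq s u"
| cong_plus: "riesz_eq s s' \<Longrightarrow> riesz_eq t t' \<Longrightarrow> riesz_eq (RPlus s t) (RPlus s' t')"
| cong_scale: "riesz_eq t t' \<Longrightarrow> riesz_eq (RScale r t) (RScale r t')"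
| cong_join: "riesz_eq s s' \<Longrightarrow> riesz_eq t t' \<Longrightarrow> riesz_eq (RJoin s t) (RJoin s' t')"
| cong_meet: "riesz_eq s s' \<Longrightarrow> riesz_eq t t' \<Longrightarrow> riesz_eq (RMeet s t) (RMeet s' t')"
| plus_assoc: "riesz_eq (RPlus (RPlus s t) u) (RPlus s (RPlus t u))"
| plus_comm: "riesz_eq (RPlus s t) (RPlus t s)"
| plus_zero: "riesz_eq (RPlus t RZero) t"
| plus_inverse: "riesz_eq (RPlus t (RScale (- 1) t)) RZero"
| scale_plus: "riesz_eq (RScale r (RPlus s t)) (RPlus (RScale r s) (RScale r t))"
| plus_scale: "riesz_eq (RScale (p + q) t) (RPlus (RScale p t) (RScale q t))"
| scale_scale: "riesz_eq (RScale p (RScale q t)) (RScale (p * q) t)"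
| scale_one: "riesz_eq (RScale 1 t) t"
| join_assoc: "riesz_eq (RJoin (RJoin s t) u) (RJoin s (RJoin t u))"
| join_comm: "riesz_eq (RJoin s t) (RJoin t s)"
| join_absorb: "riesz_eq (RJoin s (RMeet s t)) s"
| meet_assoc: "riesz_eq (RMeet (RMeet s t) u) (RMeet s (RMeet t u))"
| meet_comm: "riesz_eq (RMeet s t) (RMeet t s)"
| meet_absorb: "riesz_eq (RMeet s (RJoin s t)) s"
| plus_mono: "riesz_eq (RMeet (RPlus (RMeet s t) u) (RPlus t u)) (RPlus (RMeet s t) u)"
| scale_mono: "0 \<le> r \<Longrightarrow>
    riesz_eq (RMeet (RScale r (RMeet s t)) (RScale r t)) (RScale r (RMeet s t))"

definition riesz_le :: "rterm \<Rightarrow> rterm \<Rightarrow> bool" where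
  "riesz_le s t \<longleftrightarrow> riesz_eq (RMeet s t) s"

primrec eval_rterm :: "(nat \<Rightarrow> 'a::riesz_space) \<Rightarrow> rterm \<Rightarrow> 'a" where
  "eval_rterm v (RVar x) = v x"
| "eval_rterm v RZero = 0"
| "eval_rterm v (RPlus s t) = eval_rterm v s + eval_rterm v t"
| "eval_rterm v (RScale r t) = r *\<^sub>R eval_rterm v t"
| "eval_rterm v (RJoin s t) = sup (eval_rterm v s) (eval_rterm v t)"
| "eval_rterm v (RMeet s t) = inf (eval_rterm v s) (eval_rterm v t)"


primrec nnf_rterm :: "nnf \<Rightarrow> rterm" where
  "nnf_rterm (PVar x) = RVar x"
| "nnf_rterm (NVar x) = RScale (- 1) (RVar x)"
| "nnf_rterm Zero = RZero"
| "nnf_rterm (Plus A B) = RPlus (nnf_rterm A) (nnf_rterm B)"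
| "nnf_rterm (Scale r A) = RScale (real_of_preal r) (nnf_rterm A)"
| "nnf_rterm (Join A B) = RJoin (nnf_rterm A) (nnf_rterm B)"
| "nnf_rterm (Meet A B) = RMeet (nnf_rterm A) (nnf_rterm B)"

definition weighted_rterm :: "weighted \<Rightarrow> rterm" where
  "weighted_rterm w = RScale (real_of_preal (fst w)) (nnf_rterm (snd w))"

(* As syntactic terms, the sum of a sequent and the join of a hypersequent depend on the
   order in which the multisets are listed, so the interpretation is defined on listings. *)
definition lists_hypersequent :: "weighted list list \<Rightarrow> hypersequent \<Rightarrow> bool" where
  "lists_hypersequent Gs G \<longleftrightarrow> mset (map mset Gs) = G"

lemma ex_lists_hypersequent: "\<exists>Gs. lists_hypersequent Gs G"
proof -
  obtain Ss where Ss: "mset Ss = G"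
    using ex_mset by blast
  obtain f :: "sequent \<Rightarrow> weighted list" where "\<And>\<Gamma>. mset (f \<Gamma>) = \<Gamma>"
    using ex_mset by metis
  then have "map mset (map f Ss) = Ss"
    by (simp add: map_idI)
  then show ?thesis
    using Ss unfolding lists_hypersequent_def by metis
qed

fun sequent_rterm :: "weighted list \<Rightarrow> rterm" where
  "sequent_rterm [] = RZero"
| "sequent_rterm [w] = weighted_rterm w"
| "sequent_rterm (w # w' # ws) = RPlus (weighted_rterm w) (sequent_rterm (w' # ws))"

(* Unspecified on the empty list, which lists no hypersequent. *)
fun hypersequent_rterm :: "weighted list list \<Rightarrow> rterm" where
  "hypersequent_rterm [S] = sequent_rterm S"
| "hypersequent_rterm (S # S' # Ss) = RJoin (sequent_rterm S) (hypersequent_rterm (S' # Ss))"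

end

theory Submission
  imports Defs "HOL-Library.Lattice_Algebras"
begin

text \<open>
  In an arbitrary Riesz space, each rule of the calculus preserves the property that the join of
  the interpretations is nonnegative; the rules \<open>M\<close>, \<open>T\<close> and \<open>S\<close> use that lattice-ordered groups
  are distributive lattices, so that \<open>0 \<le> a \<squnion> u\<close> says that the negative parts of \<open>a\<close> and \<open>u\<close> are
  disjoint. Equational derivability is the case of the term algebra modulo provable equality,
  which is a Riesz space in which \<open>0 \<le> [t]\<close> means that \<open>0 \<le> t\<close> is derivable.
\<close>

section \<open>Lattice-ordered groups and Riesz spaces\<close>

context lattice_ab_group_add
begin

text \<open>The identity \<open>w + x = sup x w + inf x w\<close> turns bounds on meets with
  \<open>x\<close> into bounds on sums. Sums distribute over joins, so the bounds for
  \<open>y\<close> and \<open>z\<close> combine, and \<open>?s\<close> then cancels.\<close>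

lemma inf_sup_distrib_ab_group_add: "inf x (sup y z) = sup (inf x y) (inf x z)"
proof (rule order.antisym)
  let ?d = "sup (inf x y) (inf x z)" and ?s = "sup x (sup y z)"
  have le: "w + x \<le> ?d + ?s" if "inf x w \<le> ?d" "w \<le> sup y z" for w
  proof -
    have "w + x = sup x w + inf x w"
      by (metis add_eq_inf_sup add.commute)
    also have "\<dots> \<le> ?s + ?d"
      by (intro add_mono that sup.mono order.refl)
    finally show ?thesis
      by (simp add: add.commute)
  qed
  have "y + x \<le> ?d + ?s" "z + x \<le> ?d + ?s"
    by (rule le; simp)+
  then have "sup y z + x \<le> ?d + ?s"
    by (simp add: add_sup_distrib_right)
  moreover have "sup y z + x = inf x (sup y z) + ?s"
    by (metis add_eq_inf_sup add.commute)
  ultimately show "inf x (sup y z) \<le> ?d"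
    by simp
qed (rule distrib_inf_le)

subclass distrib_lattice
  by standard (rule distrib_imp1, rule inf_sup_distrib_ab_group_add)

text \<open>The right side expands to the meet of \<open>n + n\<close>, \<open>n + q\<close>,
  \<open>p + n\<close> and \<open>p + q\<close>, each of which is above the left side.\<close>

lemma inf_add_le_add_inf:
  assumes "0 \<le> n" "0 \<le> p" "0 \<le> q"
  shows "inf n (p + q) \<le> inf n p + inf n q"
proof -
  have "inf n (p + q) \<le> n + n" "inf n (p + q) \<le> n + q" "inf n (p + q) \<le> p + n"
    using assms by (auto intro!: le_infI1)
  then show ?thesis
    by (simp add: add_sup_inf_distribs)
qed

lemma zero_le_sup_iff_nprt: "0 \<le> sup a b \<longleftrightarrow> sup (nprt a) (nprt b) = 0"
  by (simp add: zero_le_iff_zero_nprt nprt_def inf_sup_distrib2)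

text \<open>The algebra behind rule \<open>M\<close>. The negative part of \<open>w\<close> is
  disjoint from those of \<open>a\<close> and \<open>b\<close>, because \<open>w\<close> is above
  \<open>u\<close>, yet it is bounded by their sum; hence it vanishes.\<close>

lemma zero_le_sup_add:
  assumes "0 \<le> sup a u" "0 \<le> sup b u"
  shows "0 \<le> sup (a + b) u"
proof -
  define w where "w = sup (a + b) u"
  have disj: "inf (- nprt w) (- nprt c) = 0" if "0 \<le> sup c u" for c
  proof -
    have "0 \<le> sup w c"
      using that by (rule order.trans) (simp add: w_def le_supI1 le_supI2)
    then show ?thesis
      by (simp add: zero_le_sup_iff_nprt flip: neg_sup_eq_inf del: neg_sup_eq_inf)
  qed
  \<comment> \<open>The sum on the left is below both \<open>a + b\<close> and
    \<open>0\<close>.\<close>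
  have "nprt a + nprt b \<le> nprt (a + b)"
    using add_mono[of "nprt a" a "nprt b" b] add_mono[of "nprt a" 0 "nprt b" 0]
    by (simp add: nprt_def)
  also have "\<dots> \<le> nprt w"
    by (simp add: w_def)
  finally have "- nprt w \<le> - nprt a + - nprt b"
    by (metis minus_add_distrib neg_le_iff_le)
  then have "- nprt w = inf (- nprt w) (- nprt a + - nprt b)"
    by (simp add: inf_absorb1)
  also have "\<dots> \<le> inf (- nprt w) (- nprt a) + inf (- nprt w) (- nprt b)"
    by (rule inf_add_le_add_inf) simp_all
  also have "\<dots> = 0"
    using assms by (simp add: disj)
  finally have "nprt w = 0"
    by (simp add: order.antisym)
  then show ?thesis
    by (simp add: zero_le_iff_zero_nprt w_def)
qed

lemma zero_le_sup_inf:
  assumes "0 \<le> sup a u" "0 \<le> sup b u"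
  shows "0 \<le> sup (inf a b) u"
  using assms by (simp add: sup_inf_distrib2)

end

\<comment> \<open>Scalar multiplication and the lattice operations\<close>
subclass (in riesz_space) lattice_ab_group_add ..

text \<open>Scaling by \<open>r\<close> is an order isomorphism whose inverse, scaling by
  \<open>inverse r\<close>, is monotone as well.\<close>

lemma scaleR_inf_distrib_pos:
  fixes x y :: "'a::riesz_space"
  assumes "0 < r"
  shows "r *\<^sub>R inf x y = inf (r *\<^sub>R x) (r *\<^sub>R y)"
proof (rule order.antisym)
  have "inverse r *\<^sub>R inf (r *\<^sub>R x) (r *\<^sub>R y) \<le> inf x y"
    using scaleR_left_mono[OF inf_le1, of "inverse r" "r *\<^sub>R x" "r *\<^sub>R y"]
      scaleR_left_mono[OF inf_le2, of "inverse r" "r *\<^sub>R x" "r *\<^sub>R y"] assms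
    by simp
  then have "r *\<^sub>R inverse r *\<^sub>R inf (r *\<^sub>R x) (r *\<^sub>R y) \<le> r *\<^sub>R inf x y"
    using assms by (intro scaleR_left_mono) simp_all
  then show "inf (r *\<^sub>R x) (r *\<^sub>R y) \<le> r *\<^sub>R inf x y"
    using assms by simp
qed (use assms in \<open>auto intro: scaleR_left_mono\<close>)

text \<open>The scalar 0 is covered because the vectors of the rules may be empty and then have
  weight 0.\<close>

lemma scaleR_inf_distrib:
  fixes x y :: "'a::riesz_space"
  assumes "0 \<le> r"
  shows "r *\<^sub>R inf x y = inf (r *\<^sub>R x) (r *\<^sub>R y)"
  using assms scaleR_inf_distrib_pos[of r x y] by (cases "r = 0") auto

lemma scaleR_sup_distrib:
  fixes x y :: "'a::riesz_space"
  assumes "0 \<le> r"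
  shows "r *\<^sub>R sup x y = sup (r *\<^sub>R x) (r *\<^sub>R y)"
  using assms by (simp add: sup_eq_neg_inf[of x y] sup_eq_neg_inf[of "r *\<^sub>R x"] scaleR_inf_distrib
      del: neg_inf_eq_sup)

text \<open>The negative parts \<open>n\<close> of \<open>z\<close> and \<open>r *\<^sub>R n\<close>
  of \<open>r *\<^sub>R z\<close> are comparable, so their join, which is 0, is one of the
  two.\<close>

lemma zero_le_sup_scaleR_self:
  fixes z :: "'a::riesz_space"
  assumes "0 < r" "0 \<le> sup (r *\<^sub>R z) z"
  shows "0 \<le> z"
proof -
  define n where "n = nprt z"
  have n: "n \<le> 0"
    by (simp add: n_def)
  have "nprt (r *\<^sub>R z) = r *\<^sub>R n"
    using assms(1) by (simp add: n_def nprt_def scaleR_inf_distrib_pos)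
  then have eq: "sup (r *\<^sub>R n) n = 0"
    using assms(2) by (simp add: zero_le_sup_iff_nprt n_def)
  have "n = 0"
  proof (cases "1 \<le> r")
    case True
    then have "r *\<^sub>R (- n) \<ge> 1 *\<^sub>R (- n)"
      using n by (intro scaleR_right_mono) simp_all
    then show ?thesis
      using eq by (simp add: sup_absorb2)
  next
    case False
    then have "r *\<^sub>R (- n) \<le> 1 *\<^sub>R (- n)"
      using n by (intro scaleR_right_mono) simp_all
    then have "r *\<^sub>R n = 0"
      using eq by (simp add: sup_absorb1)
    then show ?thesis
      using assms(1) by simp
  qed
  then show ?thesis
    by (simp add: zero_le_iff_zero_nprt n_def)
qed

text \<open>The algebra behind rule \<open>T\<close>. With \<open>z = sup a u\<close>, the join of
  \<open>r *\<^sub>R z\<close> and \<open>z\<close> is above that of \<open>r *\<^sub>R a\<close>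
  and \<open>u\<close>, which reduces the claim to a single element.\<close>

lemma zero_le_sup_scaleR:
  fixes a u :: "'a::riesz_space"
  assumes "0 < r" "0 \<le> sup (r *\<^sub>R a) u"
  shows "0 \<le> sup a u"
proof (rule zero_le_sup_scaleR_self)
  show "0 \<le> sup (r *\<^sub>R sup a u) (sup a u)"
    using assms(2) by (rule order.trans)
      (use assms(1) in \<open>auto simp: scaleR_sup_distrib intro: le_supI1 le_supI2\<close>)
qed (fact assms)

lemma zero_le_sup_of_zero_le_sup_add:
  fixes a b u :: "'a::riesz_space"
  assumes "0 \<le> sup (a + b) u"
  shows "0 \<le> sup (sup a b) u"
proof (rule zero_le_sup_scaleR)
  have "a + b \<le> sup a b + sup a b"
    by (intro add_mono) simp_all
  then have "a + b \<le> 2 *\<^sub>R sup a b"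
    by (simp add: scaleR_2)
  with assms show "0 \<le> sup (2 *\<^sub>R sup a b) u"
    by (meson order.trans sup.mono order.refl)
qed simp

section \<open>Soundness in every Riesz space\<close>

abbreviation eval_nnf :: "(nat \<Rightarrow> 'a::riesz_space) \<Rightarrow> nnf \<Rightarrow> 'a" where
  "eval_nnf v A \<equiv> eval_rterm v (nnf_rterm A)"

definition eval_sequent :: "(nat \<Rightarrow> 'a::riesz_space) \<Rightarrow> sequent \<Rightarrow> 'a" where
  "eval_sequent v \<Gamma> = (\<Sum>w\<in>#\<Gamma>. eval_rterm v (weighted_rterm w))"

text \<open>Says that the join of \<open>G\<close> is nonnegative without forming the join, which does not exist
  when the side hypersequent of a rule is empty.\<close>

definition nonneg_hypersequent :: "(nat \<Rightarrow> 'a::riesz_space) \<Rightarrow> hypersequent \<Rightarrow> bool" where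
  "nonneg_hypersequent v G \<longleftrightarrow> (\<forall>u. (\<forall>\<Gamma>\<in>#G. eval_sequent v \<Gamma> \<le> u) \<longrightarrow> 0 \<le> u)"

text \<open>Isolates the active sequent of a rule, giving the shape \<open>0 \<le> sup a u\<close>
  of the lattice lemmas; \<open>u\<close> stands in for the join of the side sequents.\<close>

lemma nonneg_hypersequent_add_mset:
  "nonneg_hypersequent v (add_mset \<Gamma> G) \<longleftrightarrow>
    (\<forall>u. (\<forall>\<Delta>\<in>#G. eval_sequent v \<Delta> \<le> u) \<longrightarrow> 0 \<le> sup (eval_sequent v \<Gamma>) u)"
  (is "?L \<longleftrightarrow> ?R")
proof
  assume ?L
  then show ?R
    by (simp add: nonneg_hypersequent_def le_supI2)
next
  assume R: ?R
  show ?L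
    unfolding nonneg_hypersequent_def
  proof (intro allI impI)
    fix u assume "\<forall>\<Delta>\<in>#add_mset \<Gamma> G. eval_sequent v \<Delta> \<le> u"
    then show "0 \<le> u"
      using R[rule_format, of u] by (simp add: sup_absorb2)
  qed
qed

lemma real_of_preal_pos: "0 < real_of_preal r"
  using real_of_preal[of r] by simp

lemma weight_nonneg: "0 \<le> weight rs"
  unfolding weight_def using real_of_preal_pos
  by (intro sum_list_nonneg) (auto intro: less_imp_le)

lemma weight_map_times: "weight (map (\<lambda>r. s * r) rs) = real_of_preal s * weight rs"
  by (induction rs) (simp_all add: weight_def times_preal.rep_eq distrib_left)

lemma eval_sequent_empty [simp]: "eval_sequent v {#} = 0"
  by (simp add: eval_sequent_def)

lemma eval_sequent_add [simp]: "eval_sequent v (\<Gamma> + \<Delta>) = eval_sequent v \<Gamma> + eval_sequent v \<Delta>"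
  by (simp add: eval_sequent_def)

lemma eval_sequent_weigh [simp]: "eval_sequent v (weigh rs A) = weight rs *\<^sub>R eval_nnf v A"
  by (induction rs)
    (simp_all add: eval_sequent_def weigh_def weight_def weighted_rterm_def scaleR_add_left)

lemma eval_sequent_rescale [simp]:
  "eval_sequent v (rescale r \<Gamma>) = real_of_preal r *\<^sub>R eval_sequent v \<Gamma>"
  by (induction \<Gamma>)
    (auto simp: eval_sequent_def rescale_def weighted_rterm_def times_preal.rep_eq scaleR_add_right)

lemma eval_nnf_neg [simp]: "eval_nnf v (neg A) = - eval_nnf v A"
  by (induction A) (simp_all add: scaleR_minus_right)

lemma HR_sound: "HR G \<Longrightarrow> nonneg_hypersequent v G"
proof (induction rule: HR.induct)
  case INIT
  then show ?case by (simp add: nonneg_hypersequent_def)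
next
  case (W G \<Gamma>)
  then show ?case by (simp add: nonneg_hypersequent_def)
next
  case (C \<Gamma> G)
  then show ?case by (simp add: nonneg_hypersequent_def)
next
  case (S \<Gamma>1 \<Gamma>2 G)
  show ?case
    unfolding nonneg_hypersequent_def
  proof (intro allI impI)
    fix u assume u: "\<forall>\<Delta>\<in>#add_mset \<Gamma>1 (add_mset \<Gamma>2 G). eval_sequent v \<Delta> \<le> u"
    then have "0 \<le> sup (eval_sequent v \<Gamma>1 + eval_sequent v \<Gamma>2) u"
      using S.IH by (simp add: nonneg_hypersequent_add_mset)
    then have "0 \<le> sup (sup (eval_sequent v \<Gamma>1) (eval_sequent v \<Gamma>2)) u"
      by (rule zero_le_sup_of_zero_le_sup_add)
    then show "0 \<le> u"
      using u by (simp add: sup_absorb2)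
  qed
next
  case (M \<Gamma>1 G \<Gamma>2)
  then show ?case by (simp add: nonneg_hypersequent_add_mset zero_le_sup_add)
next
  case (T r \<Gamma> G)
  then show ?case
    by (auto simp: nonneg_hypersequent_add_mset intro: zero_le_sup_scaleR[OF real_of_preal_pos[of r]])
next
  case (ID rs ss \<Gamma> G x)
  then show ?case by (simp add: nonneg_hypersequent_add_mset)
next
  case (zero \<Gamma> G rs)
  then show ?case by (simp add: nonneg_hypersequent_add_mset)
next
  case (plus \<Gamma> rs A B G)
  then show ?case by (simp add: nonneg_hypersequent_add_mset scaleR_add_right add.assoc)
next
  case (times \<Gamma> s rs A G)
  then show ?case by (simp add: nonneg_hypersequent_add_mset weight_map_times mult.commute)
next
  case (join \<Gamma> rs A B G)
  then show ?case
    \<comment> \<open>The sequent in the conclusion denotes the join of the two active sequents of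
      the premise, so both hypersequents have the same upper bounds.\<close>
    by (simp add: nonneg_hypersequent_def scaleR_sup_distrib weight_nonneg add_sup_distrib_left)
next
  case (meet \<Gamma> rs A G B)
  then show ?case
    by (simp add: nonneg_hypersequent_add_mset scaleR_inf_distrib weight_nonneg
        add_inf_distrib_left zero_le_sup_inf)
next
  case (CAN rs ss \<Gamma> A G)
  then show ?case by (simp add: nonneg_hypersequent_add_mset)
qed

lemma eval_sequent_rterm: "eval_rterm v (sequent_rterm ws) = eval_sequent v (mset ws)"
  by (induction ws rule: sequent_rterm.induct) (simp_all add: eval_sequent_def)

text \<open>Being an upper bound is all that \<open>nonneg_hypersequent\<close> asks of the join.
  The unspecified value on the empty list is harmless, as the premise is then false.\<close>

lemma eval_sequent_rterm_le_hypersequent: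
  "S \<in> set Gs \<Longrightarrow> eval_rterm v (sequent_rterm S) \<le> eval_rterm v (hypersequent_rterm Gs)"
  by (induction Gs rule: hypersequent_rterm.induct) (auto intro: le_supI2)

lemma HR_eval_nonneg:
  assumes "HR G" "lists_hypersequent Gs G"
  shows "0 \<le> eval_rterm v (hypersequent_rterm Gs)"
proof -
  have "eval_sequent v \<Gamma> \<le> eval_rterm v (hypersequent_rterm Gs)" if "\<Gamma> \<in># G" for \<Gamma>
    using that assms(2) eval_sequent_rterm_le_hypersequent[of _ Gs v]
    by (auto simp: lists_hypersequent_def eval_sequent_rterm)
  then show ?thesis
    using HR_sound[OF assms(1), of v] by (auto simp: nonneg_hypersequent_def)
qed

section \<open>The free Riesz space\<close>

quotient_type free_riesz = rterm / riesz_eq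
  by (rule equivpI)
    (auto intro!: reflpI sympI transpI intro: riesz_eq.refl riesz_eq.sym riesz_eq.trans)

instantiation free_riesz :: real_vector
begin

lift_definition zero_free_riesz :: free_riesz is RZero .

lift_definition plus_free_riesz :: "free_riesz \<Rightarrow> free_riesz \<Rightarrow> free_riesz" is RPlus
  by (rule cong_plus)

lift_definition scaleR_free_riesz :: "real \<Rightarrow> free_riesz \<Rightarrow> free_riesz" is RScale
  by (rule cong_scale)

lift_definition uminus_free_riesz :: "free_riesz \<Rightarrow> free_riesz" is "RScale (- 1)"
  by (rule cong_scale)

lift_definition minus_free_riesz :: "free_riesz \<Rightarrow> free_riesz \<Rightarrow> free_riesz"
  is "\<lambda>s t. RPlus s (RScale (- 1) t)"
  by (intro cong_plus cong_scale)

instance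
proof
  fix a b c :: free_riesz and p q :: real
  show "a + b + c = a + (b + c)"
    by transfer (rule plus_assoc)
  show "a + b = b + a"
    by transfer (rule plus_comm)
  show "0 + a = a"
    by transfer (rule riesz_eq.trans[OF plus_comm plus_zero])
  show "- a + a = 0"
    by transfer (rule riesz_eq.trans[OF plus_comm plus_inverse])
  show "a - b = a + - b"
    by transfer (rule riesz_eq.refl)
  show "p *\<^sub>R (a + b) = p *\<^sub>R a + p *\<^sub>R b"
    by transfer (rule scale_plus)
  show "(p + q) *\<^sub>R a = p *\<^sub>R a + q *\<^sub>R a"
    by transfer (rule plus_scale)
  show "p *\<^sub>R q *\<^sub>R a = (p * q) *\<^sub>R a"
    by transfer (rule scale_scale)
  show "1 *\<^sub>R a = a"
    by transfer (rule scale_one)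
qed

end

instantiation free_riesz :: "{inf, sup}"
begin

lift_definition sup_free_riesz :: "free_riesz \<Rightarrow> free_riesz \<Rightarrow> free_riesz" is RJoin
  by (rule cong_join)

lift_definition inf_free_riesz :: "free_riesz \<Rightarrow> free_riesz \<Rightarrow> free_riesz" is RMeet
  by (rule cong_meet)

instance ..

end

instantiation free_riesz :: lattice
begin

text \<open>The order is read off from meets, as in \<open>riesz_le\<close>, so that it coincides
  with derivable inequality.\<close>

definition less_eq_free_riesz :: "free_riesz \<Rightarrow> free_riesz \<Rightarrow> bool" where
  "less_eq_free_riesz x y \<longleftrightarrow> inf x y = x"

definition less_free_riesz :: "free_riesz \<Rightarrow> free_riesz \<Rightarrow> bool" where
  "less_free_riesz x y \<longleftrightarrow> x \<le> y \<and> \<not> y \<le> x"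

instance
proof
  have inf_assoc: "inf (inf a b) c = inf a (inf b c)" for a b c :: free_riesz
    by transfer (rule meet_assoc)
  have inf_comm: "inf a b = inf b a" for a b :: free_riesz
    by transfer (rule meet_comm)
  have inf_absorb: "inf a (sup a b) = a" for a b :: free_riesz
    by transfer (rule meet_absorb)
  have sup_assoc: "sup (sup a b) c = sup a (sup b c)" for a b c :: free_riesz
    by transfer (rule join_assoc)
  have sup_comm: "sup a b = sup b a" for a b :: free_riesz
    by transfer (rule join_comm)
  have sup_absorb: "sup a (inf a b) = a" for a b :: free_riesz
    by transfer (rule join_absorb)
  \<comment> \<open>Write the second \<open>a\<close> as \<open>sup a (inf a a)\<close> and
    absorb.\<close>
  have inf_idem: "inf a a = a" for a :: free_riesz
    by (metis inf_absorb sup_absorb)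
  have le_iff_sup: "a \<le> b \<longleftrightarrow> sup a b = b" for a b :: free_riesz
    unfolding less_eq_free_riesz_def by (metis inf_absorb inf_comm sup_absorb sup_comm)
  fix x y z :: free_riesz
  show "x < y \<longleftrightarrow> x \<le> y \<and> \<not> y \<le> x"
    by (rule less_free_riesz_def)
  show "x \<le> x"
    by (simp add: less_eq_free_riesz_def inf_idem)
  show "x \<le> z" if "x \<le> y" "y \<le> z"
    using that unfolding less_eq_free_riesz_def by (metis inf_assoc)
  show "x = y" if "x \<le> y" "y \<le> x"
    using that unfolding less_eq_free_riesz_def by (metis inf_comm)
  show "inf x y \<le> x" "inf x y \<le> y"
    unfolding less_eq_free_riesz_def by (metis inf_assoc inf_comm inf_idem)+
  show "x \<le> inf y z" if "x \<le> y" "x \<le> z"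
    using that unfolding less_eq_free_riesz_def by (metis inf_assoc)
  show "x \<le> sup x y" "y \<le> sup x y"
    unfolding less_eq_free_riesz_def by (metis inf_absorb sup_comm)+
  show "sup y z \<le> x" if "y \<le> x" "z \<le> x"
    using that unfolding le_iff_sup by (metis sup_assoc)
qed

end

instance free_riesz :: riesz_space
proof
  have plus_mono: "inf (inf a b + c) (b + c) = inf a b + c" for a b c :: free_riesz
    by transfer (rule plus_mono)
  have scale_mono: "inf (r *\<^sub>R inf a b) (r *\<^sub>R b) = r *\<^sub>R inf a b" if "0 \<le> r"
    for a b :: free_riesz and r
    using that by transfer (rule scale_mono)
  \<comment> \<open>The axiom speaks of \<open>inf x y\<close>, which equals \<open>x\<close> when
    \<open>x \<le> y\<close>.\<close>
  have add_right_mono: "x + z \<le> y + z" if "x \<le> y" for x y z :: free_riesz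
    using that plus_mono[of x y z] by (simp add: less_eq_free_riesz_def)
  fix x y z :: free_riesz and a b :: real
  show "z + x \<le> z + y" if "x \<le> y"
    using add_right_mono[OF that, of z] by (simp add: add.commute)
  have scaleR_left: "a *\<^sub>R x \<le> a *\<^sub>R y" if "x \<le> y" "0 \<le> a"
    for x y :: free_riesz and a :: real
    using that scale_mono[of a x y] by (simp add: less_eq_free_riesz_def)
  show "a *\<^sub>R x \<le> a *\<^sub>R y" if "x \<le> y" "0 \<le> a"
    using that by (rule scaleR_left)
  show "a *\<^sub>R x \<le> b *\<^sub>R x" if "a \<le> b" "0 \<le> x"
  proof -
    \<comment> \<open>Monotonicity in the scalar reduces to monotonicity in the vector, applied to
      \<open>0 \<le> x\<close> with the scalar \<open>b - a\<close>.\<close>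
    have "0 \<le> (b - a) *\<^sub>R x"
      using scaleR_left[of 0 x "b - a"] that by simp
    from add_right_mono[OF this, of "a *\<^sub>R x"] show ?thesis
      by (simp flip: scaleR_add_left)
  qed
qed

text \<open>Under the canonical valuation every term denotes its own class, so truth at this
  valuation is provability.\<close>

lemma eval_rterm_abs_free_riesz: "eval_rterm (\<lambda>x. abs_free_riesz (RVar x)) t = abs_free_riesz t"
  by (induction t)
    (simp_all add: zero_free_riesz_def plus_free_riesz.abs_eq scaleR_free_riesz.abs_eq
      sup_free_riesz.abs_eq inf_free_riesz.abs_eq)

lemma riesz_le_iff_abs_free_riesz: "riesz_le s t \<longleftrightarrow> abs_free_riesz s \<le> abs_free_riesz t"
  by (simp add: riesz_le_def less_eq_free_riesz_def inf_free_riesz.abs_eq free_riesz.abs_eq_iff)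

theorem theorem3p9:
  fixes G :: hypersequent
  assumes "HR G"
  shows "\<forall>Gs. lists_hypersequent Gs G \<longrightarrow>
           riesz_le RZero (hypersequent_rterm Gs) \<and>
           (\<forall>v :: nat \<Rightarrow> 'a::riesz_space. 0 \<le> eval_rterm v (hypersequent_rterm Gs))"
proof (intro allI impI conjI)
  fix Gs assume Gs: "lists_hypersequent Gs G"
  show "riesz_le RZero (hypersequent_rterm Gs)"
    \<comment> \<open>Semantic soundness, instantiated at the free Riesz space and its canonical
      valuation, yields the equational derivation.\<close>
    using HR_eval_nonneg[OF assms Gs, of "\<lambda>x. abs_free_riesz (RVar x)"]
    by (simp add: riesz_le_iff_abs_free_riesz eval_rterm_abs_free_riesz zero_free_riesz_def)
  show "0 \<le> eval_rterm v (hypersequent_rterm Gs)" for v :: "nat \<Rightarrow> 'a"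
    using assms Gs by (rule HR_eval_nonneg)
qed

end
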